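(* Let $k\in(0,1)$, let $S$ be a $t$-conorm, let $T_M(x,y)=\min(x,y)$ on $[0,1]$, and let $F_M$ be the nullnorm with absorbing element $k$ given by $$F_M(x,y)=\begin{cases} k\,S\!\left(\frac{x}{k},\frac{y}{k}\right), & (x,y)\in[0,k]^2,\\[2pt] k+(1-k)\,T_M\!\left(\frac{x-k}{1-k},\frac{y-k}{1-k}\right), & (x,y)\in(k,1]^2,\\[2pt] k, & \text{otherwise.}\end{cases}$$ A fuzzy subset $\sigma:[0,1]\to[0,1]$ is an $F_M$-fuzzy $t$-subnorm of $([0,1],T_M)$ if and only if $\sigma(1)=1$ and $\sigma(x)\ge k$ for every $x\in[0,1]$.
   Context: A $t$-conorm is a commutative, associative, coordinatewise non-decreasing operation on $[0,1]$ with identity $0$. A nullnorm with absorbing element $k$ is a commutative, associative, coordinatewise non-decreasing map $F:[0,1]^2\to[0,1]$ with $F(k,x)=k$ for all $x$, $F(0,x)=x$ for $x\le k$, and $F(1,x)=x$ for $x\ge k$. An $F_M$-fuzzy $t$-subnorm of $([0,1],T_M)$ is a map $\sigma:[0,1]\to[0,1]$ with $F_M(\sigma(x),\sigma(y))\le\sigma(T_M(x,y))$ for all $x,y\in[0,1]$ and $\sigma(1)=1$. *)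

theory Defs
  imports Complex_Main "HOL-Library.FuncSet"
begin

(* Operations on [0,1] are total functions on the reals, constrained on {0..1} only. *)

definition unit_operation :: "(real \<Rightarrow> real \<Rightarrow> real) \<Rightarrow> bool" where
  "unit_operation F \<longleftrightarrow>
     (\<forall>x\<in>{0..1}. \<forall>y\<in>{0..1}. F x y \<in> {0..1}) \<and>
     (\<forall>x\<in>{0..1}. \<forall>y\<in>{0..1}. F x y = F y x) \<and>
     (\<forall>x\<in>{0..1}. \<forall>y\<in>{0..1}. \<forall>z\<in>{0..1}. F (F x y) z = F x (F y z)) \<and>
     (\<forall>x\<in>{0..1}. \<forall>x'\<in>{0..1}. \<forall>y\<in>{0..1}. \<forall>y'\<in>{0..1}.
        x \<le> x' \<longrightarrow> y \<le> y' \<longrightarrow> F x y \<le> F x' y')"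

definition t_conorm :: "(real \<Rightarrow> real \<Rightarrow> real) \<Rightarrow> bool" where
  "t_conorm S \<longleftrightarrow> unit_operation S \<and> (\<forall>x\<in>{0..1}. S 0 x = x)"

definition nullnorm :: "real \<Rightarrow> (real \<Rightarrow> real \<Rightarrow> real) \<Rightarrow> bool" where
  "nullnorm k F \<longleftrightarrow> k \<in> {0..1} \<and> unit_operation F \<and>
     (\<forall>x\<in>{0..1}. F k x = k) \<and>
     (\<forall>x\<in>{0..k}. F 0 x = x) \<and>
     (\<forall>x\<in>{k..1}. F 1 x = x)"

definition T_M :: "real \<Rightarrow> real \<Rightarrow> real" where
  "T_M x y = min x y"

definition F_M :: "real \<Rightarrow> (real \<Rightarrow> real \<Rightarrow> real) \<Rightarrow> real \<Rightarrow> real \<Rightarrow> real" where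
  "F_M k S x y =
     (if x \<in> {0..k} \<and> y \<in> {0..k} then k * S (x / k) (y / k)
      else if x \<in> {k<..1} \<and> y \<in> {k<..1}
        then k + (1 - k) * T_M ((x - k) / (1 - k)) ((y - k) / (1 - k))
      else k)"

definition fuzzy_t_subnorm ::
  "(real \<Rightarrow> real \<Rightarrow> real) \<Rightarrow> (real \<Rightarrow> real \<Rightarrow> real) \<Rightarrow> (real \<Rightarrow> real) \<Rightarrow> bool" where
  "fuzzy_t_subnorm F T \<sigma> \<longleftrightarrow>
     \<sigma> \<in> {0..1} \<rightarrow> {0..1} \<and>
     (\<forall>x\<in>{0..1}. \<forall>y\<in>{0..1}. F (\<sigma> x) (\<sigma> y) \<le> \<sigma> (T x y)) \<and>
     \<sigma> 1 = 1"

lemma F_M_upper: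
  assumes "0 < k" "k < 1" "k < x" "x \<le> 1" "k < y" "y \<le> 1"
  shows "F_M k S x y = min x y"
proof -
  have "k + (1 - k) * T_M ((x - k) / (1 - k)) ((y - k) / (1 - k)) = min x y"
    using assms by (auto simp: T_M_def min_def divide_le_cancel)
  then show ?thesis
    using assms by (auto simp: F_M_def)
qed

lemma F_M_lower:
  assumes "0 \<le> x" "x \<le> k" "0 \<le> y" "y \<le> k"
  shows "F_M k S x y = k * S (x / k) (y / k)"
  using assms by (auto simp: F_M_def)

lemma F_M_mixed:
  assumes "x \<le> k \<and> k < y \<or> k < x \<and> y \<le> k"
  shows "F_M k S x y = k"
  using assms by (auto simp: F_M_def)

lemma nullnorm_F_M:
  assumes k: "0 < k" "k < 1" and S: "t_conorm S"
  shows "nullnorm k (F_M k S)"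
proof -
  have Scl: "0 \<le> S x y \<and> S x y \<le> 1" if "0 \<le> x" "x \<le> 1" "0 \<le> y" "y \<le> 1" for x y
    using S that by (auto simp: t_conorm_def unit_operation_def)
  have Scom: "S x y = S y x" if "0 \<le> x" "x \<le> 1" "0 \<le> y" "y \<le> 1" for x y
    using S that by (auto simp: t_conorm_def unit_operation_def)
  have Sas: "S (S x y) z = S x (S y z)"
    if "0 \<le> x" "x \<le> 1" "0 \<le> y" "y \<le> 1" "0 \<le> z" "z \<le> 1" for x y z
    using S that by (auto simp: t_conorm_def unit_operation_def)
  have Smono: "S x y \<le> S x' y'"
    if "0 \<le> x" "x \<le> x'" "x' \<le> 1" "0 \<le> y" "y \<le> y'" "y' \<le> 1" for x y x' y'
    using S that by (auto simp: t_conorm_def unit_operation_def)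
  have S0: "S 0 x = x" if "0 \<le> x" "x \<le> 1" for x
    using S that by (auto simp: t_conorm_def)
  have S1: "S 1 x = 1" if "0 \<le> x" "x \<le> 1" for x
    using Smono[of 1 1 0 x] Scom[of 1 0] S0[of 1] Scl[of 1 x] that by auto
  let ?F = "F_M k S"
  note up = F_M_upper[OF k] and lo = F_M_lower and mix = F_M_mixed
  have locl: "0 \<le> ?F x y \<and> ?F x y \<le> k" if "0 \<le> x" "x \<le> k" "0 \<le> y" "y \<le> k" for x y
    using Scl[of "x/k" "y/k"] that k by (simp add: lo mult_left_le)
  have cl: "0 \<le> ?F x y \<and> ?F x y \<le> 1" if "0 \<le> x" "x \<le> 1" "0 \<le> y" "y \<le> 1" for x y
    using locl[of x y] up[of x y] mix[of x k y] that k
    by (cases "x \<le> k"; cases "y \<le> k") auto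
  have com: "?F x y = ?F y x" if "0 \<le> x" "x \<le> 1" "0 \<le> y" "y \<le> 1" for x y
  proof -
    consider "x \<le> k" "y \<le> k" | "k < x" "k < y" | "x \<le> k" "k < y" | "k < x" "y \<le> k" by linarith
    then show ?thesis
      by cases (use that k Scom[of "x/k" "y/k"] in \<open>simp_all add: lo up mix min.commute\<close>)
  qed
  have absk: "?F k x = k" if "0 \<le> x" "x \<le> 1" for x
    using S1[of "x/k"] that k by (cases "x \<le> k") (auto simp: lo mix)
  have absk': "?F x k = k" if "0 \<le> x" "x \<le> 1" for x
    using absk[OF that] com[of x k] that k by simp
  have lodiv: "?F x y / k = S (x/k) (y/k)" if "0 \<le> x" "x \<le> k" "0 \<le> y" "y \<le> k" for x y
    using that k by (simp add: lo)
  have as: "?F (?F x y) z = ?F x (?F y z)"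
    if x: "0 \<le> x" "x \<le> 1" and y: "0 \<le> y" "y \<le> 1" and z: "0 \<le> z" "z \<le> 1" for x y z
  proof -
    have L: "?F u v = k" if "u \<le> k" "k < v" for u v using mix that by blast
    have R: "?F u v = k" if "k < u" "v \<le> k" for u v using mix that by blast
    show ?thesis
    proof (cases "x \<le> k"; cases "y \<le> k"; cases "z \<le> k")
      assume "x \<le> k" "y \<le> k" "z \<le> k"
      then have "?F (?F x y) z = k * S (?F x y / k) (z / k)"
        and "?F x (?F y z) = k * S (x / k) (?F y z / k)"
        using locl[of x y] locl[of y z] x y z by (simp_all add: lo)
      then show ?thesis
        using Sas[of "x/k" "y/k" "z/k"] x y z k \<open>x \<le> k\<close> \<open>y \<le> k\<close> \<open>z \<le> k\<close>
        by (simp add: lodiv)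
    next
      assume "\<not> x \<le> k" "\<not> y \<le> k" "\<not> z \<le> k"
      then show ?thesis using x y z by (simp add: up min.assoc)
    qed (use x y z k locl[of x y] locl[of y z] absk[of x] absk[of y] absk[of z]
          absk'[of x] absk'[of y] absk'[of z] in \<open>simp_all add: up L R\<close>)
  qed
  have mono: "?F x y \<le> ?F x' y'"
    if "0 \<le> x" "x \<le> x'" "x' \<le> 1" "0 \<le> y" "y \<le> y'" "y' \<le> 1" for x y x' y'
  proof -
    consider "x' \<le> k" "y' \<le> k" | "k < x" "k < y" | "x \<le> k \<or> y \<le> k" "k < x' \<or> k < y'"
      by linarith
    then show ?thesis
    proof cases
      case 1
      then show ?thesis
        using that k Smono[of "x/k" "x'/k" "y/k" "y'/k"]
        by (simp add: lo divide_right_mono)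
    next
      case 2
      then show ?thesis using that by (auto simp: up)
    next
      case 3
      have "?F x y \<le> k"
        using 3 that locl[of x y] mix[of x k y] by (cases "x \<le> k"; cases "y \<le> k") auto
      moreover have "k \<le> ?F x' y'"
        using 3 that up[of x' y'] mix[of x' k y'] by (cases "x' \<le> k"; cases "y' \<le> k") auto
      ultimately show ?thesis by linarith
    qed
  qed
  have e0: "?F 0 x = x" if "0 \<le> x" "x \<le> k" for x
    using that k S0[of "x/k"] by (simp add: lo)
  have e1: "?F 1 x = x" if "k \<le> x" "x \<le> 1" for x
    using that k up[of 1 x] mix[of 1 k x] by (cases "x = k") auto
  have "unit_operation ?F"
    unfolding unit_operation_def by (auto intro: com as mono dest: cl simp: cl)
  then show ?thesis
    unfolding nullnorm_def using k absk e0 e1 by auto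
qed

end

theory Submission
  imports Defs
begin

text \<open>On \<open>[k,1]\<close> squared \<open>F_M\<close> is the minimum
  (\<open>F_M_eq_min\<close>), and for any map \<open>\<sigma>\<close> the value at
  \<open>min x y\<close> is \<open>\<sigma> x\<close> or \<open>\<sigma> y\<close>, hence at least
  their minimum; so values above \<open>k\<close> suffice. Conversely, combining
  \<open>\<sigma> 1 = 1\<close> with a value below \<open>k\<close> gives exactly \<open>k\<close>
  (\<open>F_M_mixed\<close>), while \<open>T_M 1 x = x\<close>; the subnorm inequality then forces
  \<open>k \<le> \<sigma> x\<close>.\<close>

text \<open>Extends \<open>F_M_upper\<close> to the edges \<open>u = k\<close> and
  \<open>v = k\<close>, where absorption by \<open>k\<close> gives the minimum. The corner falls
  under the t-conorm branch, with value \<open>k * S 1 1\<close>, so absorption is taken from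
  \<open>nullnorm_F_M\<close>.\<close>

lemma F_M_eq_min:
  assumes k: "0 < k" "k < 1" and S: "t_conorm S"
    and u: "k \<le> u" "u \<le> 1" and v: "k \<le> v" "v \<le> 1"
  shows "F_M k S u v = min u v"
proof -
  have nn: "nullnorm k (F_M k S)"
    using nullnorm_F_M[OF k S] .
  have absk: "F_M k S k w = k" if "k \<le> w" "w \<le> 1" for w
    using nn that k by (auto simp: nullnorm_def)
  moreover have "F_M k S u k = F_M k S k u"
    using nn u k by (auto simp: nullnorm_def unit_operation_def)
  ultimately show ?thesis
    using F_M_upper[OF k, of u v S] u v
    by (cases "u = k"; cases "v = k") auto
qed

theorem proposition3p12:
  fixes k :: real and S :: "real \<Rightarrow> real \<Rightarrow> real" and \<sigma> :: "real \<Rightarrow> real"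
  assumes "0 < k" and "k < 1"
    and "t_conorm S"
    and "\<sigma> \<in> {0..1} \<rightarrow> {0..1}"
  shows "fuzzy_t_subnorm (F_M k S) T_M \<sigma> \<longleftrightarrow>
           \<sigma> 1 = 1 \<and> (\<forall>x\<in>{0..1}. k \<le> \<sigma> x)"
proof
  assume sub: "fuzzy_t_subnorm (F_M k S) T_M \<sigma>"
  then have one: "\<sigma> 1 = 1"
    by (simp add: fuzzy_t_subnorm_def)
  have "k \<le> \<sigma> x" if x: "x \<in> {0..1}" for x
  proof (rule ccontr)
    assume "\<not> k \<le> \<sigma> x"
    \<comment> \<open>The arguments lie on opposite sides of \<open>k\<close>, as
      \<open>\<sigma> x < k < 1 = \<sigma> 1\<close>.\<close>
    then have "F_M k S (\<sigma> 1) (\<sigma> x) = k"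
      using one \<open>k < 1\<close> by (intro F_M_mixed) auto
    moreover have "F_M k S (\<sigma> 1) (\<sigma> x) \<le> \<sigma> (T_M 1 x)"
      using sub x unfolding fuzzy_t_subnorm_def by (meson atLeastAtMost_iff order_refl zero_le_one)
    moreover have "T_M 1 x = x"
      using x by (simp add: T_M_def)
    ultimately show False
      using \<open>\<not> k \<le> \<sigma> x\<close> by simp
  qed
  with one show "\<sigma> 1 = 1 \<and> (\<forall>x\<in>{0..1}. k \<le> \<sigma> x)"
    by blast
next
  assume rhs: "\<sigma> 1 = 1 \<and> (\<forall>x\<in>{0..1}. k \<le> \<sigma> x)"
  have "F_M k S (\<sigma> x) (\<sigma> y) \<le> \<sigma> (T_M x y)" if "x \<in> {0..1}" "y \<in> {0..1}" for x y
  proof -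
    have "\<sigma> x \<le> 1" "\<sigma> y \<le> 1"
      using assms(4) that by (auto simp: Pi_iff)
    then have "F_M k S (\<sigma> x) (\<sigma> y) = min (\<sigma> x) (\<sigma> y)"
      using F_M_eq_min[OF assms(1-3)] rhs that by blast
    \<comment> \<open>\<open>T_M x y\<close> is one of \<open>x\<close> and \<open>y\<close>, so its
      image is one of the two values whose minimum is taken.\<close>
    then show ?thesis
      by (auto simp: T_M_def min_def)
  qed
  with rhs assms(4) show "fuzzy_t_subnorm (F_M k S) T_M \<sigma>"
    by (simp add: fuzzy_t_subnorm_def)
qed

end
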